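(* Let $T=(V,E)$ be a tree and let $\{\langle X_t,G_t\rangle\}_{t\ge 0}$, $G_t=(V,E,C_t)$, be a proper, monotone decreasing, possibly adaptive random walk in changing environment on $T$. Suppose that it is bounded from below by some transient weighted tree $G_\infty=(V,E,C_\infty)$ with positive conductances (that is, $C_t(e)\ge C_\infty(e)$ for all $e\in E$ and all $t$, almost surely). Then the walk is transient, i.e. almost surely $X_t$ visits every vertex of $T$ only finitely many times.
   Context: A random walk in changing environment (RWCE) on a graph $G=(V,E)$ is a stochastic process $\{\langle X_t,G_t\rangle\}_{t=0}^\infty$ where $X_t\in V$ and $G_t=(V,E,C_t)$ is the graph $G$ equipped with a (random) conductance function $C_t:E\to[0,\infty)$, with total conductance at each vertex finite, such that for all $t$ and $v$, $$\mathbb{P}(X_{t+1}=v\mid \langle X_0,G_0\rangle,\dots,\langle X_t,G_t\rangle)=\frac{C_t(X_t,v)}{\sum_{e\in E: X_t\in e}C_t(e)}.$$ The conductances $C_t$ may depend on the whole history of the process and on extra randomness; "possibly adaptive" means no restriction is placed on this dependence. The RWCE is proper if $0<C_t(e)<\infty$ for all $t$ and $e$. It is monotone decreasing if $C_{t+1}\le C_t$ (edgewise) almost surely for all $t$. A fixed (deterministic) weighted graph is called transient if the usual weighted (reversible) random walk on it is transient. *)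

theory Defs
  imports "HOL-Probability.Probability"
begin

text \<open>Graphs are simple, undirected and possibly infinite, given by a vertex set \<open>V\<close> and a set
  \<open>E\<close> of two-element subsets of \<open>V\<close>. The trees of \<open>Graph_Theory\<close> are not used: there
  \<open>forest\<close> only excludes directed cycles.\<close>

definition simple_graph :: "'v set \<Rightarrow> 'v set set \<Rightarrow> bool" where
  "simple_graph V E \<longleftrightarrow> (\<forall>e\<in>E. e \<subseteq> V \<and> card e = 2)"

definition connected_graph :: "'v set \<Rightarrow> 'v set set \<Rightarrow> bool" where
  "connected_graph V E \<longleftrightarrow>
     (\<forall>u\<in>V. \<forall>v\<in>V. \<exists>p. p \<noteq> [] \<and> hd p = u \<and> last p = v \<and> successively (\<lambda>x y. {x, y} \<in> E) p)"

definition graph_cycle :: "'v set set \<Rightarrow> 'v list \<Rightarrow> bool" where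
  "graph_cycle E p \<longleftrightarrow>
     3 \<le> length p \<and> distinct p \<and> successively (\<lambda>x y. {x, y} \<in> E) p \<and> {last p, hd p} \<in> E"

definition tree_graph :: "'v set \<Rightarrow> 'v set set \<Rightarrow> bool" where
  "tree_graph V E \<longleftrightarrow>
     simple_graph V E \<and> V \<noteq> {} \<and> connected_graph V E \<and> (\<nexists>p. graph_cycle E p)"

definition weighted_graph :: "'v set \<Rightarrow> 'v set set \<Rightarrow> ('v set \<Rightarrow> real) \<Rightarrow> bool" where
  "weighted_graph V E c \<longleftrightarrow>
     simple_graph V E \<and> (\<forall>e\<in>E. 0 \<le> c e) \<and> (\<forall>x\<in>V. c summable_on {e\<in>E. x \<in> e})"

definition transition_prob :: "'v set set \<Rightarrow> ('v set \<Rightarrow> real) \<Rightarrow> 'v \<Rightarrow> 'v \<Rightarrow> real" where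
  "transition_prob E c x y = (if {x, y} \<in> E then c {x, y} else 0) / (\<Sum>\<^sub>\<infinity>e\<in>{e\<in>E. x \<in> e}. c e)"

text \<open>The sigma-algebra generated by \<open>X\<^sub>0, C\<^sub>0, \<dots>, X\<^sub>t, C\<^sub>t\<close>.\<close>

definition history ::
  "'w measure \<Rightarrow> 'v set \<Rightarrow> 'v set set \<Rightarrow> (nat \<Rightarrow> 'w \<Rightarrow> 'v) \<Rightarrow> (nat \<Rightarrow> 'w \<Rightarrow> 'v set \<Rightarrow> real) \<Rightarrow> nat \<Rightarrow> 'w measure"
where
  "history M V E X C t = sigma (space M)
     ({X s -` A \<inter> space M | s A. s \<le> t \<and> A \<subseteq> V} \<union>
      {(\<lambda>\<omega>. C s \<omega> e) -` B \<inter> space M | s e B. s \<le> t \<and> e \<in> E \<and> B \<in> sets borel})"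

text \<open>The law of the next step is prescribed only conditionally on the history of the pairs
  \<open>\<langle>X\<^sub>s, G\<^sub>s\<rangle>\<close>. Adaptivity is unrestricted: \<open>C t\<close> may be any random
  conductance function, and \<open>M\<close> may carry further randomness.\<close>

locale rwce = prob_space M
  for M :: "'w measure" +
  fixes V :: "'v set"
    and E :: "'v set set"
    and X :: "nat \<Rightarrow> 'w \<Rightarrow> 'v"
    and C :: "nat \<Rightarrow> 'w \<Rightarrow> 'v set \<Rightarrow> real"
  assumes X_measurable: "\<And>t. X t \<in> measurable M (count_space V)"
    and C_measurable: "\<And>t e. e \<in> E \<Longrightarrow> (\<lambda>\<omega>. C t \<omega> e) \<in> borel_measurable M"
    and weighted: "\<And>t \<omega>. \<omega> \<in> space M \<Longrightarrow> weighted_graph V E (C t \<omega>)"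
    and step: "\<And>t v. v \<in> V \<Longrightarrow>
      AE \<omega> in M. real_cond_exp M (history M V E X C t) (indicator {\<omega> \<in> space M. X (Suc t) \<omega> = v}) \<omega>
        = transition_prob E (C t \<omega>) (X t \<omega>) v"

definition proper_environment ::
  "'w measure \<Rightarrow> 'v set set \<Rightarrow> (nat \<Rightarrow> 'w \<Rightarrow> 'v set \<Rightarrow> real) \<Rightarrow> bool" where
  "proper_environment M E C \<longleftrightarrow> (AE \<omega> in M. \<forall>t. \<forall>e\<in>E. 0 < C t \<omega> e)"

definition monotone_decreasing_environment ::
  "'w measure \<Rightarrow> 'v set set \<Rightarrow> (nat \<Rightarrow> 'w \<Rightarrow> 'v set \<Rightarrow> real) \<Rightarrow> bool" where
  "monotone_decreasing_environment M E C \<longleftrightarrow>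
     (AE \<omega> in M. \<forall>t. \<forall>e\<in>E. C (Suc t) \<omega> e \<le> C t \<omega> e)"

definition transient_process :: "'w measure \<Rightarrow> 'v set \<Rightarrow> (nat \<Rightarrow> 'w \<Rightarrow> 'v) \<Rightarrow> bool" where
  "transient_process M V X \<longleftrightarrow> (AE \<omega> in M. \<forall>v\<in>V. finite {t. X t \<omega> = v})"

text \<open>The usual weighted random walk is the RWCE whose environment is constantly \<open>c\<close>; here it is
  realised as the coordinate process on path space.\<close>

definition weighted_walk_law ::
  "'v set \<Rightarrow> 'v set set \<Rightarrow> ('v set \<Rightarrow> real) \<Rightarrow> 'v \<Rightarrow> (nat \<Rightarrow> 'v) measure \<Rightarrow> bool" where
  "weighted_walk_law V E c x P \<longleftrightarrow>
     sets P = sets (Pi\<^sub>M UNIV (\<lambda>_. count_space V)) \<and>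
     rwce P V E (\<lambda>t \<omega>. \<omega> t) (\<lambda>_ _. c) \<and>
     (AE \<omega> in P. \<omega> 0 = x)"

text \<open>For countable \<open>V\<close> the law \<open>P\<close> of the walk from \<open>x\<close> is determined by \<open>c\<close> and \<open>x\<close>, so
  \<open>\<exists>P\<close> means ``for the law of the walk from \<open>x\<close>''; a universal quantifier would make graphs
  without any walk (an isolated vertex) transient.\<close>

definition transient_weighted_graph :: "'v set \<Rightarrow> 'v set set \<Rightarrow> ('v set \<Rightarrow> real) \<Rightarrow> bool" where
  "transient_weighted_graph V E c \<longleftrightarrow>
     weighted_graph V E c \<and>
     (\<forall>x\<in>V. \<exists>P. weighted_walk_law V E c x P \<and> transient_process P V (\<lambda>t \<omega>. \<omega> t))"

end

(* Let r be a vertex and let f(v) be the probability that the walk in the bounding network c, started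
   at v, never visits r; f vanishes at r, is c-harmonic elsewhere, increases along the tree away from
   r, and its flow c(u,v) (f(v) - f(u)) has a positive total D out of r by transience. On a tree any
   flow is the gradient of a potential with respect to any conductances, so for every t this one flow
   has a C_t-potential h_t with h_t(r) = 0, which is C_t-harmonic off r. As C_t decreases to no less
   than c, h_t increases in t and stays below f <= 1. Hence E h_t(X_t) is nondecreasing, bounded by 1,
   and gains D / pi_t(r) >= D / pi_0(r) in expectation at each visit to r, where pi_t(r) is the total
   conductance at r; so there are almost surely finitely many visits. *)

theory Submission
  imports Defs
begin

section \<open>Rooted trees\<close>

text \<open>The root is an arbitrary vertex: the final theorem takes every vertex in turn as the one
  whose visits are counted.\<close>

locale rooted_tree =
  fixes V :: "'v set" and E :: "'v set set" and r :: 'v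
  assumes tree: "tree_graph V E" and root_in: "r \<in> V"
begin

lemma edge_in: assumes "{u, v} \<in> E" shows "u \<in> V" "v \<in> V" "u \<noteq> v"
proof -
  have "{u, v} \<subseteq> V" "card {u, v} = 2"
    using tree assms unfolding tree_graph_def simple_graph_def by auto
  then show "u \<in> V" "v \<in> V" "u \<noteq> v" by auto
qed

text \<open>\<open>level n\<close> holds the endpoints of walks of length \<open>n\<close> from
  \<open>r\<close>. Walks may backtrack, so levels can overlap; the distance from \<open>r\<close>
  is recovered by \<open>LEAST\<close> in \<open>depth\<close>.\<close>

fun level :: "nat \<Rightarrow> 'v set" where
  "level 0 = {r}"
| "level (Suc n) = {v. \<exists>u\<in>level n. {u, v} \<in> E}"

lemma successively_level:
  assumes "successively (\<lambda>x y. {x, y} \<in> E) p" "p \<noteq> []" "hd p \<in> level n"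
  shows "\<exists>m. last p \<in> level m"
  using assms
proof (induction p arbitrary: n)
  case (Cons a p)
  show ?case
  proof (cases "p = []")
    case False
    then have "{a, hd p} \<in> E" "successively (\<lambda>x y. {x, y} \<in> E) p"
      using Cons.prems(1) by (auto simp: successively_Cons)
    moreover from this have "hd p \<in> level (Suc n)" using Cons.prems(3) by auto
    ultimately show ?thesis using Cons.IH[of "Suc n"] False by simp
  qed (use Cons.prems in auto)
qed simp

lemma in_some_level: assumes "v \<in> V" shows "\<exists>n. v \<in> level n"
proof -
  obtain p where "p \<noteq> []" "hd p = r" "last p = v" "successively (\<lambda>x y. {x, y} \<in> E) p"
    using tree root_in assms unfolding tree_graph_def connected_graph_def by blast
  then show ?thesis using successively_level[of p 0] by auto
qed

definition depth :: "'v \<Rightarrow> nat" where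
  "depth v = (LEAST n. v \<in> level n)"

lemma level_depth: "v \<in> V \<Longrightarrow> v \<in> level (depth v)"
  unfolding depth_def by (rule LeastI_ex) (rule in_some_level)

lemma depth_le: "v \<in> level n \<Longrightarrow> depth v \<le> n"
  unfolding depth_def by (rule Least_le)

lemma depth_root [simp]: "depth r = 0"
  using depth_le[of r 0] by simp

lemma depth_eq_0: "v \<in> V \<Longrightarrow> depth v = 0 \<Longrightarrow> v = r"
  using level_depth[of v] by simp

text \<open>A choice, because uniqueness of the neighbour closer to \<open>r\<close> is only
  established by \<open>edge_parent\<close>, from acyclicity. Nothing is specified about
  \<open>parent r\<close>.\<close>

definition parent :: "'v \<Rightarrow> 'v" where
  "parent v = (SOME u. {u, v} \<in> E \<and> depth v = Suc (depth u))"

lemma parent: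
  assumes "v \<in> V" "v \<noteq> r"
  shows parent_edge: "{parent v, v} \<in> E" and depth_parent: "depth v = Suc (depth (parent v))"
proof -
  obtain m where m: "depth v = Suc m"
    using assms depth_eq_0 by (metis not0_implies_Suc)
  then obtain u where u: "u \<in> level m" "{u, v} \<in> E"
    using level_depth[OF assms(1)] by auto
  \<comment> \<open>\<open>u\<close> is the last but one vertex of a shortest walk to
    \<open>v\<close>; minimality of both depths forces a difference of exactly one.\<close>
  have "v \<in> level (Suc (depth u))"
    using u(2) level_depth[OF edge_in(1)[OF u(2)]] by auto
  then have "depth v = Suc (depth u)"
    using depth_le[OF u(1)] depth_le[of v "Suc (depth u)"] m by simp
  with u(2) have "\<exists>u. {u, v} \<in> E \<and> depth v = Suc (depth u)" by blast
  then have "{parent v, v} \<in> E \<and> depth v = Suc (depth (parent v))"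
    unfolding parent_def by (rule someI_ex)
  then show "{parent v, v} \<in> E" "depth v = Suc (depth (parent v))" by auto
qed

lemma parent_in: "v \<in> V \<Longrightarrow> v \<noteq> r \<Longrightarrow> parent v \<in> V"
  using parent_edge edge_in by blast

lemma depth_induct [consumes 1, case_names root parent]:
  assumes "v \<in> V" "P r" "\<And>v. v \<in> V \<Longrightarrow> v \<noteq> r \<Longrightarrow> P (parent v) \<Longrightarrow> P v"
  shows "P v"
  using assms(1)
proof (induction "depth v" arbitrary: v rule: less_induct)
  case less
  show ?case
  proof (cases "v = r")
    case False
    with less.prems have "depth (parent v) < depth v" by (simp add: depth_parent)
    then show ?thesis using less False parent_in assms(3) by blast
  qed (simp add: assms(2))
qed

text \<open>Ensures that every term of the sum \<open>flow_potential\<close> refers to a genuine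
  edge, which its measurability requires.\<close>

lemma funpow_parent:
  assumes "v \<in> V" "i < depth v"
  shows "(parent ^^ i) v \<in> V" "(parent ^^ i) v \<noteq> r"
proof -
  have "(parent ^^ i) v \<in> V \<and> depth ((parent ^^ i) v) + i = depth v" if "i \<le> depth v" for i
    using that
  proof (induction i)
    case (Suc i)
    then have "(parent ^^ i) v \<in> V" "depth ((parent ^^ i) v) \<noteq> 0" "depth ((parent ^^ i) v) + i = depth v"
      by auto
    moreover from this have "(parent ^^ i) v \<noteq> r" by (metis depth_root)
    ultimately show ?case using parent_in[of "(parent ^^ i) v"] depth_parent[of "(parent ^^ i) v"] by auto
  qed (use assms in auto)
  from this[of i] assms(2) show "(parent ^^ i) v \<in> V" "(parent ^^ i) v \<noteq> r" by auto
qed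

text \<open>Prepend \<open>v\<close> to the line of its parent. The depth bound strengthens the
  induction: it shows that \<open>v\<close> is new, so the list stays distinct.\<close>

lemma ancestors:
  assumes "v \<in> V"
  shows "\<exists>p. p \<noteq> [] \<and> hd p = v \<and> last p = r \<and> distinct p \<and>
    successively (\<lambda>x y. {x, y} \<in> E \<and> y = parent x) p \<and> (\<forall>x\<in>set p. depth x \<le> depth v)"
  using assms
proof (induction v rule: depth_induct)
  case root
  then show ?case by (intro exI[of _ "[r]"]) simp
next
  case (parent v)
  then obtain p where p: "p \<noteq> []" "hd p = parent v" "last p = r" "distinct p"
    "successively (\<lambda>x y. {x, y} \<in> E \<and> y = parent x) p" "\<forall>x\<in>set p. depth x \<le> depth (parent v)" by blast
  with parent.hyps parent_edge[of v] depth_parent[of v] show ?case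
    by (intro exI[of _ "v # p"]) (auto simp: successively_Cons insert_commute)
qed

text \<open>If an edge joined two vertices neither of which is the parent of the other, it would close a
  cycle together with their lines of ancestors up to the first common one.\<close>

lemma edge_parent:
  assumes e: "{u, v} \<in> E"
  shows "u \<noteq> r \<and> parent u = v \<or> v \<noteq> r \<and> parent v = u"
proof (rule ccontr)
  assume neg: "\<not> ?thesis"
  obtain p where p: "p \<noteq> []" "hd p = u" "last p = r" "distinct p"
    "successively (\<lambda>x y. {x, y} \<in> E \<and> y = parent x) p"
    using ancestors[OF edge_in(1)[OF e]] by blast
  obtain q where q: "q \<noteq> []" "hd q = v" "last q = r" "distinct q"
    "successively (\<lambda>x y. {x, y} \<in> E \<and> y = parent x) q"
    using ancestors[OF edge_in(2)[OF e]] by blast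
  have "r \<in> set p" "r \<in> set q" using p q last_in_set by metis+
  \<comment> \<open>\<open>y\<close> is the first vertex on the way from \<open>u\<close> to
    \<open>r\<close> that also lies on the way from \<open>v\<close>. As \<open>p1\<close> misses
    \<open>q\<close>, climbing from \<open>u\<close> to \<open>y\<close> and descending to
    \<open>v\<close> repeats no vertex.\<close>
  then obtain p1 y p2 where p': "p = p1 @ y # p2" "y \<in> set q" "\<forall>x\<in>set p1. x \<notin> set q"
    using split_list_first_prop[of p "\<lambda>x. x \<in> set q"] by blast
  obtain q1 q2 where q': "q = q1 @ y # q2"
    using split_list[OF p'(2)] by blast
  let ?c = "p1 @ y # rev q1"
  have hd_c: "hd ?c = u" using p(2) p'(1) by (cases p1) auto
  have last_c: "last ?c = v" using q(2) q' by (cases q1) (auto simp: last_rev)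
  have "distinct ?c" using p(4) q(4) p' q' by auto
  moreover have "successively (\<lambda>x y. {x, y} \<in> E) ?c"
  proof -
    have sp: "successively (\<lambda>x y. {x, y} \<in> E) p1" "p1 \<noteq> [] \<Longrightarrow> {last p1, y} \<in> E"
      using p(5) p'(1) by (auto simp: successively_append_iff intro: successively_mono)
    have sq: "successively (\<lambda>x y. {x, y} \<in> E) q1" "q1 \<noteq> [] \<Longrightarrow> {last q1, y} \<in> E"
      using q(5) q' by (auto simp: successively_append_iff intro: successively_mono)
    have "successively (\<lambda>x y. {x, y} \<in> E) (rev q1)"
      using sq(1) by (simp add: successively_rev insert_commute)
    then show ?thesis using sp sq
      by (auto simp: successively_append_iff successively_Cons hd_rev insert_commute)
  qed
  moreover have "3 \<le> length ?c"
  proof (rule ccontr)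
    assume "\<not> 3 \<le> length ?c"
    \<comment> \<open>With fewer than three vertices, either \<open>u = v\<close> or one of the two
      is the parent of the other.\<close>
    then consider "p1 = []" "q1 = []" | x where "p1 = [x]" "q1 = []" | x where "p1 = []" "q1 = [x]"
      by (cases p1; cases q1) (auto simp: Suc_le_eq)
    then show False
    proof cases
      case 1
      then show ?thesis using hd_c last_c edge_in(3)[OF e] by simp
    next
      case (2 x)
      then have "parent u = v" using p(5) p'(1) hd_c last_c by (auto simp: successively_Cons)
      moreover have "u \<noteq> r" using 2 p(3,4) p'(1) hd_c by (auto split: if_splits)
      ultimately show ?thesis using neg by simp
    next
      case (3 x)
      then have "parent v = u" using q(5) q' hd_c last_c by (auto simp: successively_Cons)
      moreover have "v \<noteq> r" using 3 q(3,4) q' last_c by (auto split: if_splits)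
      ultimately show ?thesis using neg by simp
    qed
  qed
  moreover have "{last ?c, hd ?c} \<in> E" using hd_c last_c e by (simp add: insert_commute)
  ultimately have "graph_cycle E ?c" unfolding graph_cycle_def by blast
  then show False using tree unfolding tree_graph_def by blast
qed

text \<open>Connectedness exhausts \<open>V\<close> by levels, and each level is covered by the
  countably many edges at the previous one.\<close>

lemma countable_vertices:
  assumes "\<And>x. x \<in> V \<Longrightarrow> countable {e \<in> E. x \<in> e}"
  shows "countable V"
proof -
  have card2: "countable e" if "e \<in> E" for e
  proof -
    have "card e = 2" using tree that unfolding tree_graph_def simple_graph_def by auto
    then have "finite e" using card_ge_0_finite[of e] by simp
    then show ?thesis by (rule countable_finite)
  qed
  have sub: "level n \<subseteq> V" for n
    by (induction n) (use root_in edge_in in auto)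
  have "countable (level n)" for n
  proof (induction n)
    case (Suc n)
    have "countable (\<Union>u\<in>level n. \<Union>e\<in>{e \<in> E. u \<in> e}. e)"
      by (intro countable_UN Suc assms) (use sub card2 in auto)
    moreover have "level (Suc n) \<subseteq> (\<Union>u\<in>level n. \<Union>e\<in>{e \<in> E. u \<in> e}. e)" by auto
    ultimately show ?case by (rule countable_subset[rotated])
  qed simp
  then have "countable (\<Union>n. level n)" by blast
  then show ?thesis by (rule countable_subset[rotated]) (use in_some_level in auto)
qed

end

section \<open>Weighted graphs\<close>

text \<open>This lemma and its converse below link two languages: flows are signed and need real
  sums, while exchanging limits and integrals is done with nonnegative integrals.\<close>

lemma nn_integral_count_space_has_sum:
  fixes g :: "'a \<Rightarrow> real"
  assumes "(g has_sum S) A" "\<And>x. x \<in> A \<Longrightarrow> 0 \<le> g x"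
  shows "(\<integral>\<^sup>+x. ennreal (g x) \<partial>count_space A) = ennreal S"
proof -
  have "g summable_on A" using assms(1) by (auto simp: summable_on_def)
  then have *: "Infinite_Set_Sum.abs_summable_on g A"
    using abs_summable_equivalent summable_on_iff_abs_summable_on_real by blast
  show ?thesis
    using nn_integral_conv_infsetsum[OF *] infsetsum_infsum[OF *] assms infsumI by force
qed

lemma has_sum_nn_integral_count_space:
  fixes g :: "'a \<Rightarrow> real"
  assumes "(\<integral>\<^sup>+x. ennreal (g x) \<partial>count_space A) = ennreal S" "0 \<le> S" "\<And>x. x \<in> A \<Longrightarrow> 0 \<le> g x"
  shows "(g has_sum S) A"
proof -
  have "Infinite_Set_Sum.abs_summable_on g A"
    unfolding abs_summable_on_def
    by (rule integrableI_nonneg) (use assms in \<open>auto simp: AE_count_space\<close>)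
  then have "g summable_on A"
    using abs_summable_equivalent summable_on_iff_abs_summable_on_real by blast
  then have *: "(g has_sum infsum g A) A" by (rule has_sum_infsum)
  have "ennreal (infsum g A) = ennreal S"
    using nn_integral_count_space_has_sum[OF *] assms by simp
  moreover have "0 \<le> infsum g A" by (rule infsum_nonneg) (use assms in auto)
  ultimately show ?thesis using * assms(2) by simp
qed

text \<open>An edge at \<open>x\<close> is determined by its other endpoint, so the edge sum can be
  reindexed by vertices, with 0 at non-neighbours.\<close>

lemma has_sum_incident:
  assumes "weighted_graph V E c" "x \<in> V"
  shows "((\<lambda>u. if {x, u} \<in> E then c {x, u} else 0) has_sum (\<Sum>\<^sub>\<infinity>e\<in>{e\<in>E. x \<in> e}. c e)) V"
proof -
  have bij: "bij_betw (\<lambda>u. {x, u}) {u \<in> V. {x, u} \<in> E} {e \<in> E. x \<in> e}"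
    unfolding bij_betw_def
  proof (intro conjI set_eqI iffI)
    show "inj_on (\<lambda>u. {x, u}) {u \<in> V. {x, u} \<in> E}" by (auto simp: inj_on_def doubleton_eq_iff)
  next
    fix e assume e: "e \<in> {e \<in> E. x \<in> e}"
    then have "card e = 2" "e \<subseteq> V" using assms unfolding weighted_graph_def simple_graph_def by auto
    with e obtain u where "e = {x, u}" "u \<in> V" by (auto simp: card_2_iff)
    then show "e \<in> (\<lambda>u. {x, u}) ` {u \<in> V. {x, u} \<in> E}" using e by auto
  qed auto
  have "(c has_sum (\<Sum>\<^sub>\<infinity>e\<in>{e\<in>E. x \<in> e}. c e)) {e \<in> E. x \<in> e}"
    using assms unfolding weighted_graph_def by (auto intro: has_sum_infsum)
  then have "((\<lambda>u. c {x, u}) has_sum (\<Sum>\<^sub>\<infinity>e\<in>{e\<in>E. x \<in> e}. c e)) {u \<in> V. {x, u} \<in> E}"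
    using has_sum_reindex_bij_betw[OF bij, of c] by simp
  then show ?thesis
    by (rule has_sum_cong_neutral[THEN iffD1, rotated -1]) auto
qed

lemma incident_sum_pos:
  assumes "weighted_graph V E c" "x \<in> V" "e \<in> E" "x \<in> e" "0 < c e"
  shows "0 < (\<Sum>\<^sub>\<infinity>e\<in>{e\<in>E. x \<in> e}. c e)"
proof -
  have s: "c summable_on {e \<in> E. x \<in> e}" "\<forall>e\<in>E. 0 \<le> c e"
    using assms unfolding weighted_graph_def by auto
  have "sum c {e} \<le> (\<Sum>\<^sub>\<infinity>e\<in>{e\<in>E. x \<in> e}. c e)"
    by (rule finite_sum_le_infsum) (use s assms in auto)
  then show ?thesis using assms(5) by simp
qed

lemma transition_prob_nonneg:
  assumes "weighted_graph V E c"
  shows "0 \<le> transition_prob E c x y"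
  using assms unfolding transition_prob_def weighted_graph_def
  by (auto intro!: divide_nonneg_nonneg infsum_nonneg)

text \<open>If the total conductance vanishes, division by zero makes all transition probabilities
  0, so in general the rows are only substochastic.\<close>

lemma has_sum_transition_prob:
  assumes "weighted_graph V E c" "x \<in> V"
  shows "(transition_prob E c x has_sum
    (if (\<Sum>\<^sub>\<infinity>e\<in>{e\<in>E. x \<in> e}. c e) = 0 then 0 else 1)) V"
proof -
  let ?s = "\<Sum>\<^sub>\<infinity>e\<in>{e\<in>E. x \<in> e}. c e"
  have "((\<lambda>u. (if {x, u} \<in> E then c {x, u} else 0) * inverse ?s) has_sum ?s * inverse ?s) V"
    by (rule has_sum_cmult_left[OF has_sum_incident[OF assms]])
  then show ?thesis
    unfolding transition_prob_def[abs_def] divide_inverse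
    by (rule back_subst[where P = "\<lambda>s. (_ has_sum s) V"]) simp
qed

lemma nn_integral_transition_prob_le:
  assumes "weighted_graph V E c" "x \<in> V"
  shows "(\<integral>\<^sup>+v. ennreal (transition_prob E c x v) \<partial>count_space V) \<le> 1"
  using nn_integral_count_space_has_sum[OF has_sum_transition_prob[OF assms]]
    transition_prob_nonneg[OF assms(1)] by (simp split: if_splits)

text \<open>The numbers \<open>c {x, u} * (h u - h x)\<close> are the flow out of \<open>x\<close> driven by the potential \<open>h\<close>.\<close>

lemma has_sum_transition_prob_potential:
  assumes w: "weighted_graph V E c" and x: "x \<in> V"
    and pos: "0 < (\<Sum>\<^sub>\<infinity>e\<in>{e\<in>E. x \<in> e}. c e)"
  shows "((\<lambda>u. transition_prob E c x u * h u) has_sum h x + D / (\<Sum>\<^sub>\<infinity>e\<in>{e\<in>E. x \<in> e}. c e)) V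
    \<longleftrightarrow> ((\<lambda>u. if {x, u} \<in> E then c {x, u} * (h u - h x) else 0) has_sum D) V"
    (is "?L \<longleftrightarrow> ?R")
proof -
  let ?s = "\<Sum>\<^sub>\<infinity>e\<in>{e\<in>E. x \<in> e}. c e"
  have p: "((\<lambda>u. h x * transition_prob E c x u) has_sum h x) V"
    using has_sum_cmult_right[OF has_sum_transition_prob[OF w x], of "h x"] pos by simp
  \<comment> \<open>Scaling by the total conductance turns the summands of the expected increment of
    \<open>h\<close> into edge flows; the subtracted part sums to \<open>h x\<close> because the
    probabilities sum to 1.\<close>
  have eq: "?s * (transition_prob E c x u * h u - h x * transition_prob E c x u) =
    (if {x, u} \<in> E then c {x, u} * (h u - h x) else 0)" for u
    using pos by (auto simp: transition_prob_def field_simps)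
  show ?thesis
  proof
    assume ?L
    moreover have "((\<lambda>u. - (h x * transition_prob E c x u)) has_sum - h x) V"
      using has_sum_uminusI[OF p] by simp
    ultimately have "((\<lambda>u. transition_prob E c x u * h u + - (h x * transition_prob E c x u)) has_sum
        h x + D / ?s + - h x) V"
      by (rule has_sum_add)
    from has_sum_cmult_right[OF this, of ?s] show ?R
      using pos by (simp add: eq[symmetric])
  next
    assume ?R
    then have "((\<lambda>u. ?s * (transition_prob E c x u * h u - h x * transition_prob E c x u)) has_sum D) V"
      by (simp only: eq)
    from has_sum_add[OF p has_sum_cmult_right[OF this, of "1 / ?s"]] show ?L
      using pos by (simp add: field_simps)
  qed
qed

section \<open>One step of the walk\<close>

lemma borel_measurable_nn_integral_count_space:
  fixes f :: "'i \<Rightarrow> 'a \<Rightarrow> ennreal"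
  assumes "countable I" "\<And>i. i \<in> I \<Longrightarrow> f i \<in> borel_measurable M"
  shows "(\<lambda>x. \<integral>\<^sup>+i. f i x \<partial>count_space I) \<in> borel_measurable M"
proof (cases "finite I")
  case True
  then show ?thesis using assms(2) by (simp add: nn_integral_count_space_finite)
next
  case False
  then have bij: "bij_betw (from_nat_into I) UNIV I"
    using bij_betw_from_nat_into[OF assms(1)] by simp
  have "(\<integral>\<^sup>+i. f i x \<partial>count_space I) = (\<Sum>n. f (from_nat_into I n) x)" for x
    by (simp add: nn_integral_bij_count_space[symmetric, OF bij] nn_integral_count_space_nat)
  moreover have "f (from_nat_into I n) \<in> borel_measurable M" for n
    using assms(2) False by (auto intro!: from_nat_into)
  ultimately show ?thesis by simp
qed

context rwce
begin

lemma X_in: "\<omega> \<in> space M \<Longrightarrow> X t \<omega> \<in> V"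
  using measurable_space[OF X_measurable[of t]] by simp

lemma
  shows space_history [simp]: "space (history M V E X C t) = space M"
    and sets_history: "sets (history M V E X C t) = sigma_sets (space M)
     ({X s -` A \<inter> space M | s A. s \<le> t \<and> A \<subseteq> V} \<union>
      {(\<lambda>\<omega>. C s \<omega> e) -` B \<inter> space M | s e B. s \<le> t \<and> e \<in> E \<and> B \<in> sets borel})"
  unfolding history_def by (subst space_measure_of sets_measure_of; auto)+

lemma subalgebra_history: "subalgebra M (history M V E X C t)"
  unfolding subalgebra_def sets_history
proof (intro conjI sets.sigma_sets_subset subsetI)
  fix A assume "A \<in> {X s -` A \<inter> space M | s A. s \<le> t \<and> A \<subseteq> V} \<union>
      {(\<lambda>\<omega>. C s \<omega> e) -` B \<inter> space M | s e B. s \<le> t \<and> e \<in> E \<and> B \<in> sets borel}"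
  then show "A \<in> sets M"
    using X_measurable C_measurable by (auto intro!: measurable_sets)
qed simp

lemma subalgebra_history_mono:
  "s \<le> t \<Longrightarrow> subalgebra (history M V E X C t) (history M V E X C s)"
  unfolding subalgebra_def sets_history
  by (intro conjI sigma_sets_mono' Un_mono subsetI) (simp, (clarsimp, metis le_trans)+)

lemma X_history: "s \<le> t \<Longrightarrow> X s \<in> measurable (history M V E X C t) (count_space V)"
  unfolding measurable_def using X_in by (auto simp: sets_history intro!: sigma_sets.Basic)

lemma C_history:
  "s \<le> t \<Longrightarrow> e \<in> E \<Longrightarrow> (\<lambda>\<omega>. C s \<omega> e) \<in> borel_measurable (history M V E X C t)"
  unfolding measurable_def by (auto simp: sets_history intro!: sigma_sets.Basic)

text \<open>For nonnegative summable conductances the sum is an integral over a countable counting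
  measure, and measurability is inherited from the individual edges.\<close>

lemma incident_sum_measurable:
  assumes "countable E"
  shows "(\<lambda>\<omega>. \<Sum>\<^sub>\<infinity>e\<in>{e\<in>E. x \<in> e}. C t \<omega> e) \<in> borel_measurable M"
proof (cases "x \<in> V")
  case True
  have eq: "(\<Sum>\<^sub>\<infinity>e\<in>{e\<in>E. x \<in> e}. C t \<omega> e) =
    enn2real (\<integral>\<^sup>+e. ennreal (C t \<omega> e) \<partial>count_space {e\<in>E. x \<in> e})" if "\<omega> \<in> space M" for \<omega>
  proof -
    have w: "C t \<omega> summable_on {e \<in> E. x \<in> e}" "\<forall>e\<in>E. 0 \<le> C t \<omega> e"
      using weighted[OF that, of t] True unfolding weighted_graph_def by auto
    have "0 \<le> (\<Sum>\<^sub>\<infinity>e\<in>{e\<in>E. x \<in> e}. C t \<omega> e)" by (rule infsum_nonneg) (use w in auto)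
    then show ?thesis
      using nn_integral_count_space_has_sum[OF has_sum_infsum[OF w(1)]] w(2) by simp
  qed
  have "(\<lambda>\<omega>. \<integral>\<^sup>+e. ennreal (C t \<omega> e) \<partial>count_space {e\<in>E. x \<in> e}) \<in> borel_measurable M"
    by (rule borel_measurable_nn_integral_count_space)
      (use assms C_measurable in \<open>auto intro: countable_subset[of _ E]\<close>)
  then show ?thesis by (simp add: eq cong: measurable_cong)
next
  case False
  show ?thesis
  proof (cases "space M = {}")
    case False
    then obtain \<omega> where "\<omega> \<in> space M" by blast
    then have "e \<subseteq> V" if "e \<in> E" for e
      using weighted that unfolding weighted_graph_def simple_graph_def by blast
    with \<open>x \<notin> V\<close> have "{e \<in> E. x \<in> e} = {}" by auto
    show ?thesis unfolding \<open>{e \<in> E. x \<in> e} = {}\<close> by simp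
  qed (simp add: measurable_def)
qed

text \<open>The payoff \<open>Z\<close> may be random as long as the history determines it; this is
  what allows adaptive environments. Decompose by the value of the next position and condition each
  term on the history. All uses of the transition law go through this identity.\<close>

lemma nn_integral_step:
  assumes V: "countable V"
    and Z: "\<And>v. v \<in> V \<Longrightarrow> Z v \<in> borel_measurable (history M V E X C t)"
  shows "(\<integral>\<^sup>+\<omega>. Z (X (Suc t) \<omega>) \<omega> \<partial>M) =
    (\<integral>\<^sup>+\<omega>. (\<integral>\<^sup>+v. Z v \<omega> * ennreal (transition_prob E (C t \<omega>) (X t \<omega>) v) \<partial>count_space V) \<partial>M)"
proof -
  let ?F = "history M V E X C t"
  interpret finite_measure_subalgebra M ?F
    using subalgebra_history by unfold_locales
  define g :: "'v \<Rightarrow> 'w \<Rightarrow> real" where "g v = indicator {\<omega> \<in> space M. X (Suc t) \<omega> = v}" for v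
  define K where "K v = nn_cond_exp M ?F (\<lambda>\<omega>. ennreal (g v \<omega>))" for v
  have g_meas: "g v \<in> borel_measurable M" if "v \<in> V" for v
  proof -
    have "X (Suc t) -` {v} \<inter> space M \<in> sets M"
      by (rule measurable_sets[OF X_measurable]) (use that in simp)
    also have "X (Suc t) -` {v} \<inter> space M = {\<omega> \<in> space M. X (Suc t) \<omega> = v}" by auto
    finally show ?thesis unfolding g_def by simp
  qed
  have Z_meas: "Z v \<in> borel_measurable M" if "v \<in> V" for v
    by (rule measurable_from_subalg[OF subalgebra_history Z[OF that]])
  have K_meas: "K v \<in> borel_measurable M" for v
    unfolding K_def by simp
  have K_AE: "AE \<omega> in M. \<forall>v\<in>V. K v \<omega> = ennreal (transition_prob E (C t \<omega>) (X t \<omega>) v)"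
  proof (rule AE_ball_countable[OF V, THEN iffD2], intro ballI)
    fix v assume v: "v \<in> V"
    note [measurable] = g_meas[OF v]
    have g01: "0 \<le> g v \<omega>" "g v \<omega> \<le> 1" for \<omega> unfolding g_def by (auto simp: indicator_def)
    \<comment> \<open>\<open>real_cond_exp\<close> is a difference of \<open>enn2real\<close> values
      for the positive and negative parts. The negative part is 0 and the positive one is at most 1,
      so no infinite value is lost and the result agrees with \<open>K v\<close>.\<close>
    have "AE \<omega> in M. K v \<omega> \<le> nn_cond_exp M ?F (\<lambda>_. 1) \<omega>"
      unfolding K_def by (rule nn_cond_exp_mono) (use g01 in auto)
    moreover have "AE \<omega> in M. 1 = nn_cond_exp M ?F (\<lambda>_. 1) \<omega>"
      by (rule nn_cond_exp_F_meas) simp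
    moreover have "AE \<omega> in M. 0 = nn_cond_exp M ?F (\<lambda>_. 0) \<omega>"
      by (rule nn_cond_exp_F_meas) simp
    moreover have "(\<lambda>\<omega>. ennreal (- g v \<omega>)) = (\<lambda>_. 0)" using g01 by (auto simp: ennreal_neg)
    ultimately have "AE \<omega> in M. K v \<omega> = ennreal (real_cond_exp M ?F (g v) \<omega>)"
      unfolding real_cond_exp_def K_def
      by (auto simp: ennreal_enn2real_if top_unique elim!: eventually_elim2)
    with step[OF v, of t, folded g_def]
    show "AE \<omega> in M. K v \<omega> = ennreal (transition_prob E (C t \<omega>) (X t \<omega>) v)"
      by eventually_elim simp
  qed
  have "(\<integral>\<^sup>+\<omega>. Z (X (Suc t) \<omega>) \<omega> \<partial>M) =
    (\<integral>\<^sup>+\<omega>. (\<integral>\<^sup>+v. Z v \<omega> * ennreal (g v \<omega>) \<partial>count_space V) \<partial>M)"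
  proof (rule nn_integral_cong)
    fix \<omega> assume \<omega>: "\<omega> \<in> space M"
    \<comment> \<open>Only the term with \<open>v = X (Suc t) \<omega>\<close> survives.\<close>
    have "(\<integral>\<^sup>+v. Z v \<omega> * ennreal (g v \<omega>) \<partial>count_space V) =
        (\<Sum>v\<in>{X (Suc t) \<omega>}. Z v \<omega> * ennreal (g v \<omega>))"
      by (rule nn_integral_count_space') (use \<omega> X_in in \<open>auto simp: g_def\<close>)
    then show "Z (X (Suc t) \<omega>) \<omega> = (\<integral>\<^sup>+v. Z v \<omega> * ennreal (g v \<omega>) \<partial>count_space V)"
      using \<omega> by (simp add: g_def)
  qed
  also have "\<dots> = (\<integral>\<^sup>+v. (\<integral>\<^sup>+\<omega>. Z v \<omega> * ennreal (g v \<omega>) \<partial>M) \<partial>count_space V)"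
    by (rule nn_integral_count_space_nn_integral[OF V]) (use Z_meas g_meas in simp)
  \<comment> \<open>Since \<open>Z v\<close> is measurable for the history, the indicator
    \<open>g v\<close> may be replaced by its conditional expectation.\<close>
  also have "\<dots> = (\<integral>\<^sup>+v. (\<integral>\<^sup>+\<omega>. Z v \<omega> * K v \<omega> \<partial>M) \<partial>count_space V)"
    unfolding K_def
    by (rule nn_integral_cong, rule nn_cond_exp_intg[symmetric]) (use Z g_meas in simp_all)
  also have "\<dots> = (\<integral>\<^sup>+\<omega>. (\<integral>\<^sup>+v. Z v \<omega> * K v \<omega> \<partial>count_space V) \<partial>M)"
    by (rule nn_integral_count_space_nn_integral[OF V, symmetric]) (use Z_meas K_meas in simp)
  also have "\<dots> = (\<integral>\<^sup>+\<omega>. (\<integral>\<^sup>+v. Z v \<omega> * ennreal (transition_prob E (C t \<omega>) (X t \<omega>) v) \<partial>count_space V) \<partial>M)"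
  proof (rule nn_integral_cong_AE)
    from K_AE show "AE \<omega> in M. (\<integral>\<^sup>+v. Z v \<omega> * K v \<omega> \<partial>count_space V) =
      (\<integral>\<^sup>+v. Z v \<omega> * ennreal (transition_prob E (C t \<omega>) (X t \<omega>) v) \<partial>count_space V)"
      by eventually_elim (auto intro!: nn_integral_cong)
  qed
  finally show ?thesis .
qed

end

section \<open>The escape potential\<close>

text \<open>The probability that the walk from \<open>x\<close> is not at \<open>r\<close> at any of the times \<open>1, \<dots>, n\<close>.\<close>

primrec avoid :: "'v set \<Rightarrow> 'v set set \<Rightarrow> ('v set \<Rightarrow> real) \<Rightarrow> 'v \<Rightarrow> nat \<Rightarrow> 'v \<Rightarrow> ennreal" where
  "avoid V E c r 0 x = 1"
| "avoid V E c r (Suc n) x = (\<integral>\<^sup>+v. ennreal (transition_prob E c x v) *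
     (indicator (- {r}) v * avoid V E c r n v) \<partial>count_space V)"

text \<open>Substochasticity gives the first step, and monotonicity of the integral propagates
  it.\<close>

lemma avoid_Suc_le:
  assumes "weighted_graph V E c" "x \<in> V"
  shows "avoid V E c r (Suc n) x \<le> avoid V E c r n x"
  using assms(2)
proof (induction n arbitrary: x)
  case 0
  have "avoid V E c r (Suc 0) x \<le> (\<integral>\<^sup>+v. ennreal (transition_prob E c x v) \<partial>count_space V)"
    unfolding avoid.simps by (rule nn_integral_mono) (auto split: split_indicator)
  also have "\<dots> \<le> 1" by (rule nn_integral_transition_prob_le[OF assms(1) 0])
  finally show ?case by simp
next
  case (Suc n)
  show ?case
    unfolding avoid.simps(2)[of V E c r "Suc n"] avoid.simps(2)[of V E c r n x]
    by (rule nn_integral_mono, intro mult_left_mono Suc.IH) auto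
qed

lemma avoid_le_1:
  assumes "weighted_graph V E c" "x \<in> V"
  shows "avoid V E c r n x \<le> 1"
proof (induction n)
  case (Suc n)
  with avoid_Suc_le[OF assms] show ?case by (rule order_trans)
qed simp

lemma LIMSEQ_avoid:
  assumes "weighted_graph V E c" "x \<in> V"
  shows "(\<lambda>n. avoid V E c r n x) \<longlonglongrightarrow> (INF n. avoid V E c r n x)"
  by (rule LIMSEQ_INF) (use avoid_Suc_le[OF assms] in \<open>auto intro: decseq_SucI simp del: avoid.simps(2)\<close>)

text \<open>Pass to the limit in the recursion, dominated by the transition probabilities, whose
  total is at most 1. This yields harmonicity of the escape probability off
  \<open>r\<close>.\<close>

lemma INF_avoid:
  assumes w: "weighted_graph V E c" and x: "x \<in> V"
  shows "(INF n. avoid V E c r n x) = (\<integral>\<^sup>+v. ennreal (transition_prob E c x v) *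
     (indicator (- {r}) v * (INF n. avoid V E c r n v)) \<partial>count_space V)"
proof (rule LIMSEQ_unique)
  show "(\<lambda>n. avoid V E c r (Suc n) x) \<longlonglongrightarrow> (INF n. avoid V E c r n x)"
    by (rule LIMSEQ_Suc[OF LIMSEQ_avoid[OF w x]])
  show "(\<lambda>n. avoid V E c r (Suc n) x) \<longlonglongrightarrow> (\<integral>\<^sup>+v. ennreal (transition_prob E c x v) *
     (indicator (- {r}) v * (INF n. avoid V E c r n v)) \<partial>count_space V)"
    unfolding avoid.simps
  proof (rule nn_integral_dominated_convergence[where w = "\<lambda>v. ennreal (transition_prob E c x v)"])
    show "(\<integral>\<^sup>+v. ennreal (transition_prob E c x v) \<partial>count_space V) < \<infinity>"
      using nn_integral_transition_prob_le[OF w x] by (simp add: order.strict_trans1)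
    fix n
    show "AE v in count_space V. ennreal (transition_prob E c x v) * (indicator (- {r}) v * avoid V E c r n v)
       \<le> ennreal (transition_prob E c x v)"
    proof (intro AE_I2)
      fix v assume "v \<in> space (count_space V)"
      then have "indicator (- {r}) v * avoid V E c r n v \<le> 1"
        using avoid_le_1[OF w, of v r n] by (auto split: split_indicator)
      from mult_left_mono[OF this, of "ennreal (transition_prob E c x v)"]
      show "ennreal (transition_prob E c x v) * (indicator (- {r}) v * avoid V E c r n v)
         \<le> ennreal (transition_prob E c x v)" by simp
    qed
  next
    show "AE v in count_space V. (\<lambda>n. ennreal (transition_prob E c x v) * (indicator (- {r}) v * avoid V E c r n v))
       \<longlonglongrightarrow> ennreal (transition_prob E c x v) * (indicator (- {r}) v * (INF n. avoid V E c r n v))"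
      by (intro AE_I2 ennreal_tendsto_cmult LIMSEQ_avoid[OF w]) (auto split: split_indicator)
  qed auto
qed

text \<open>The Markov property over \<open>n\<close> steps. \<open>Z\<close> carries the past: the
  induction moves from time \<open>k\<close> to \<open>Suc k\<close> by absorbing one indicator into
  \<open>Z\<close>. Time \<open>k\<close> itself is excluded, as in \<open>avoid\<close>.\<close>

lemma nn_integral_avoid:
  assumes rw: "rwce M V E X (\<lambda>_ _. c)" and V: "countable V"
    and Z: "Z \<in> borel_measurable (history M V E X (\<lambda>_ _. c) k)"
  shows "(\<integral>\<^sup>+\<omega>. Z \<omega> * (\<Prod>i\<in>{k<..k+n}. indicator (- {r}) (X i \<omega>)) \<partial>M) =
    (\<integral>\<^sup>+\<omega>. Z \<omega> * avoid V E c r n (X k \<omega>) \<partial>M)"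
  using Z
proof (induction n arbitrary: Z k)
  case (Suc n)
  interpret rwce M V E X "\<lambda>_ _. c" by (rule rw)
  let ?F = "history M V E X (\<lambda>_ _. c)"
  have "{k<..k + Suc n} = insert (Suc k) {Suc k<..Suc k + n}" by auto
  then have "(\<integral>\<^sup>+\<omega>. Z \<omega> * (\<Prod>i\<in>{k<..k+Suc n}. indicator (- {r}) (X i \<omega>)) \<partial>M) =
    (\<integral>\<^sup>+\<omega>. (Z \<omega> * indicator (- {r}) (X (Suc k) \<omega>)) * (\<Prod>i\<in>{Suc k<..Suc k+n}. indicator (- {r}) (X i \<omega>)) \<partial>M)"
    by (simp add: mult.assoc)
  also have "\<dots> = (\<integral>\<^sup>+\<omega>. (Z \<omega> * indicator (- {r}) (X (Suc k) \<omega>)) * avoid V E c r n (X (Suc k) \<omega>) \<partial>M)"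
  proof (rule Suc.IH)
    have "Z \<in> borel_measurable (?F (Suc k))"
      by (rule measurable_from_subalg[OF subalgebra_history_mono Suc.prems]) simp
    moreover have "(\<lambda>\<omega>. indicator (- {r}) (X (Suc k) \<omega>) :: ennreal) \<in> borel_measurable (?F (Suc k))"
      by (rule measurable_compose[OF X_history]) auto
    ultimately show "(\<lambda>\<omega>. Z \<omega> * indicator (- {r}) (X (Suc k) \<omega>)) \<in> borel_measurable (?F (Suc k))"
      by simp
  qed
  also have "\<dots> = (\<integral>\<^sup>+\<omega>. (\<integral>\<^sup>+v. (Z \<omega> * indicator (- {r}) v * avoid V E c r n v) *
      ennreal (transition_prob E c (X k \<omega>) v) \<partial>count_space V) \<partial>M)"
    by (rule nn_integral_step[OF V]) (use Suc.prems in simp)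
  also have "\<dots> = (\<integral>\<^sup>+\<omega>. Z \<omega> * avoid V E c r (Suc n) (X k \<omega>) \<partial>M)"
    by (intro nn_integral_cong) (simp add: nn_integral_cmult[symmetric] ac_simps)
  finally show ?case .
qed simp

text \<open>The event that \<open>k\<close> is the time of the last visit has probability at most
  \<open>avoid V E c r n r\<close> for every \<open>n\<close>, hence probability 0.\<close>

lemma AE_return:
  assumes rw: "rwce M V E X (\<lambda>_ _. c)" and V: "countable V" "r \<in> V"
    and 0: "(INF n. avoid V E c r n r) = 0"
  shows "AE \<omega> in M. X k \<omega> = r \<longrightarrow> (\<exists>j>k. X j \<omega> = r)"
proof -
  interpret rwce M V E X "\<lambda>_ _. c" by (rule rw)
  let ?A = "{\<omega> \<in> space M. X k \<omega> = r \<and> (\<forall>j>k. X j \<omega> \<noteq> r)}"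
  have X_at: "{\<omega> \<in> space M. X i \<omega> = r} \<in> sets M" for i
    using measurable_sets[OF X_measurable[of i], of "{r}"] V(2)
    by (simp add: vimage_def Int_def conj_commute)
  have A: "?A \<in> sets M"
  proof -
    have "?A = {\<omega> \<in> space M. X k \<omega> = r} - (\<Union>j\<in>{k<..}. {\<omega> \<in> space M. X j \<omega> = r})" by auto
    then show ?thesis using X_at by auto
  qed
  have Z: "(\<lambda>\<omega>. indicator {r} (X k \<omega>) :: ennreal) \<in> borel_measurable (history M V E X (\<lambda>_ _. c) k)"
    by (rule measurable_compose[OF X_history]) auto
  have "emeasure M ?A \<le> avoid V E c r n r" for n
  proof -
    have "emeasure M ?A = (\<integral>\<^sup>+\<omega>. indicator ?A \<omega> \<partial>M)" using A by simp
    also have "\<dots> \<le> (\<integral>\<^sup>+\<omega>. indicator {r} (X k \<omega>) * (\<Prod>i\<in>{k<..k+n}. indicator (- {r}) (X i \<omega>)) \<partial>M)"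
      by (rule nn_integral_mono) (auto simp: indicator_def)
    also have "\<dots> = (\<integral>\<^sup>+\<omega>. indicator {r} (X k \<omega>) * avoid V E c r n (X k \<omega>) \<partial>M)"
      by (rule nn_integral_avoid[OF rw V(1) Z])
    also have "\<dots> \<le> (\<integral>\<^sup>+\<omega>. avoid V E c r n r \<partial>M)"
      by (rule nn_integral_mono) (auto split: split_indicator)
    also have "\<dots> = avoid V E c r n r" by (simp add: emeasure_space_1)
    finally show ?thesis .
  qed
  then have "emeasure M ?A \<le> (INF n. avoid V E c r n r)" by (rule INF_greatest)
  with A 0 have "?A \<in> null_sets M" by auto
  then show ?thesis by (rule AE_I') auto
qed

text \<open>Otherwise almost surely no visit to \<open>r\<close> is the last one. But the visits of
  the walk started at \<open>r\<close> form a finite nonempty set, which has a maximum.\<close>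

lemma transient_INF_avoid_pos:
  assumes tr: "transient_weighted_graph V E c" and V: "countable V" "r \<in> V"
  shows "0 < (INF n. avoid V E c r n r)"
proof (rule ccontr)
  assume "\<not> ?thesis"
  then have 0: "(INF n. avoid V E c r n r) = 0" by (simp add: not_less)
  obtain P where P: "weighted_walk_law V E c r P" "transient_process P V (\<lambda>t \<omega>. \<omega> t)"
    using tr V(2) unfolding transient_weighted_graph_def by blast
  then have rw: "rwce P V E (\<lambda>t \<omega>. \<omega> t) (\<lambda>_ _. c)" and start: "AE \<omega> in P. \<omega> 0 = r"
    unfolding weighted_walk_law_def by auto
  interpret rwce P V E "\<lambda>t \<omega>. \<omega> t" "\<lambda>_ _. c" by (rule rw)
  have "AE \<omega> in P. \<forall>k. \<omega> k = r \<longrightarrow> (\<exists>j>k. \<omega> j = r)"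
    using AE_return[OF rw V 0] by (simp add: AE_all_countable)
  moreover have "AE \<omega> in P. \<forall>v\<in>V. finite {t. \<omega> t = v}"
    using P(2) unfolding transient_process_def .
  ultimately have "AE \<omega> in P. False"
    using start
  proof eventually_elim
    case (elim \<omega>)
    let ?S = "{t. \<omega> t = r}"
    have S: "finite ?S" "?S \<noteq> {}" using elim V(2) by auto
    then have "\<omega> (Max ?S) = r" using Max_in[OF S] by simp
    with elim obtain j where "Max ?S < j" "\<omega> j = r" by blast
    with S show False using Max_ge[of ?S j] by auto
  qed
  then show False by simp
qed

section \<open>Escape probabilities along a rooted tree\<close>

context rooted_tree
begin

text \<open>A summable family has only countably many nonzero terms, so positive conductances force
  countable degrees.\<close>

lemma countable_vertices_weighted:
  assumes "weighted_graph V E c" "\<forall>e\<in>E. 0 < c e"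
  shows "countable V"
proof (rule countable_vertices)
  fix x assume "x \<in> V"
  then have "countable {e \<in> {e \<in> E. x \<in> e}. c e \<noteq> 0}"
    using assms(1) unfolding weighted_graph_def by (intro summable_countable_real) auto
  then show "countable {e \<in> E. x \<in> e}"
    by (rule countable_subset[rotated]) (use assms(2) in force)
qed

lemma incident_sum_pos_nonroot:
  assumes "weighted_graph V E c" "\<forall>e\<in>E. 0 < c e" "x \<in> V" "x \<noteq> r"
  shows "0 < (\<Sum>\<^sub>\<infinity>e\<in>{e\<in>E. x \<in> e}. c e)"
  using incident_sum_pos[OF assms(1,3) parent_edge[OF assms(3,4)]] parent_edge[OF assms(3,4)] assms(2)
  by auto

text \<open>To reach \<open>r\<close> from \<open>v\<close> the walk has to pass through the parent of \<open>v\<close>.\<close>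

lemma avoid_parent_le:
  assumes w: "weighted_graph V E c" and pos: "\<forall>e\<in>E. 0 < c e" and v: "v \<in> V" "v \<noteq> r"
  shows "indicator (- {r}) (parent v) * avoid V E c r n (parent v) \<le> avoid V E c r n v"
  using v
proof (induction n arbitrary: v)
  case 0
  then show ?case by (auto split: split_indicator)
next
  case (Suc n)
  let ?f = "\<lambda>v. indicator (- {r}) v * avoid V E c r n v"
  note s = incident_sum_pos_nonroot[OF w pos Suc.prems]
  \<comment> \<open>One step of time is given up at the parent, so that the induction hypothesis at
    \<open>n\<close> applies; the transition probabilities from \<open>v\<close> then average a
    constant.\<close>
  have "indicator (- {r}) (parent v) * avoid V E c r (Suc n) (parent v) \<le> ?f (parent v)"
    by (intro mult_left_mono avoid_Suc_le[OF w] parent_in Suc.prems) auto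
  also have "\<dots> = (\<integral>\<^sup>+u. ennreal (transition_prob E c v u) \<partial>count_space V) * ?f (parent v)"
    using nn_integral_count_space_has_sum[OF has_sum_transition_prob[OF w Suc.prems(1)]]
      transition_prob_nonneg[OF w] s by simp
  also have "\<dots> = (\<integral>\<^sup>+u. ennreal (transition_prob E c v u) * ?f (parent v) \<partial>count_space V)"
    by (simp add: nn_integral_multc)
  also have "\<dots> \<le> (\<integral>\<^sup>+u. ennreal (transition_prob E c v u) * ?f u \<partial>count_space V)"
  proof (rule nn_integral_mono)
    fix u
    show "ennreal (transition_prob E c v u) * ?f (parent v) \<le> ennreal (transition_prob E c v u) * ?f u"
    proof (cases "{v, u} \<in> E")
      case True
      have "?f (parent v) \<le> ?f u"
      proof (cases "u = parent v")
        case False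
        \<comment> \<open>Every other neighbour is a child of \<open>v\<close>, and the induction
          hypothesis is applied twice, from \<open>parent v\<close> to \<open>v\<close> and from
          \<open>v\<close> to \<open>u\<close>.\<close>
        with edge_parent[OF True] have u: "u \<noteq> r" "parent u = v" by auto
        have "?f (parent v) \<le> avoid V E c r n v" by (rule Suc.IH[OF Suc.prems])
        also have "\<dots> \<le> ?f u"
          using Suc.IH[OF edge_in(2)[OF True] u(1)] u Suc.prems by simp
        finally show ?thesis .
      qed simp
      then show ?thesis by (rule mult_left_mono) simp
    qed (simp add: transition_prob_def)
  qed
  finally show ?case by simp
qed

text \<open>\<open>f\<close> is the probability of never being at \<open>r\<close>, time 0 included.
  \<open>D\<close> is the total conductance at \<open>r\<close> times the probability of never
  returning, that is, the effective conductance from \<open>r\<close> to infinity.\<close>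

lemma escape_potential:
  assumes tr: "transient_weighted_graph V E c" and pos: "\<forall>e\<in>E. 0 < c e"
  obtains f D where "f r = 0" "0 < D"
    and "\<And>v. v \<in> V \<Longrightarrow> 0 \<le> f v" "\<And>v. v \<in> V \<Longrightarrow> f v \<le> 1"
    and "\<And>v. v \<in> V \<Longrightarrow> v \<noteq> r \<Longrightarrow> f (parent v) \<le> f v"
    and "\<And>x. x \<in> V \<Longrightarrow> ((\<lambda>u. if {x, u} \<in> E then c {x, u} * (f u - f x) else 0)
      has_sum (if x = r then D else 0)) V"
proof -
  have w: "weighted_graph V E c" using tr unfolding transient_weighted_graph_def by simp
  have V: "countable V" by (rule countable_vertices_weighted[OF w pos])
  let ?s = "\<Sum>\<^sub>\<infinity>e\<in>{e\<in>E. r \<in> e}. c e"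
  \<comment> \<open>\<open>a\<close> ignores the starting time, so \<open>a r\<close> is the
    probability of no return, whereas \<open>f r = 0\<close>. The two agree off
    \<open>r\<close>.\<close>
  define a where "a x = enn2real (INF n. avoid V E c r n x)" for x
  define f where "f x = (if x = r then 0 else a x)" for x
  have INF_le: "(INF n. avoid V E c r n x) \<le> 1" for x
    using INF_lower2[of 0 UNIV "\<lambda>n. avoid V E c r n x" 1] by simp
  have a: "(INF n. avoid V E c r n x) = ennreal (a x)" "0 \<le> a x" "a x \<le> 1" if "x \<in> V" for x
    unfolding a_def using ennreal_enn2real[OF order.strict_trans1[OF INF_le ennreal_one_less_top]]
      enn2real_leI[OF _ INF_le[folded ennreal_1]]
    by simp_all
  have f: "0 \<le> f x" "f x \<le> 1" if "x \<in> V" for x using a[OF that] by (auto simp: f_def)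
  have f_eq: "indicator (- {r}) x * (INF n. avoid V E c r n x) = ennreal (f x)" if "x \<in> V" for x
    using a[OF that] by (simp add: f_def)
  have harm: "((\<lambda>u. transition_prob E c x u * f u) has_sum a x) V" if x: "x \<in> V" for x
  proof (rule has_sum_nn_integral_count_space)
    have "ennreal (a x) = (\<integral>\<^sup>+u. ennreal (transition_prob E c x u) *
        (indicator (- {r}) u * (INF n. avoid V E c r n u)) \<partial>count_space V)"
      using INF_avoid[OF w x] a(1)[OF x] by simp
    also have "\<dots> = (\<integral>\<^sup>+u. ennreal (transition_prob E c x u * f u) \<partial>count_space V)"
      by (rule nn_integral_cong) (simp add: f_eq ennreal_mult' transition_prob_nonneg[OF w])
    finally show "(\<integral>\<^sup>+u. ennreal (transition_prob E c x u * f u) \<partial>count_space V) = ennreal (a x)" ..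
  qed (use a[OF x] f transition_prob_nonneg[OF w] in auto)
  have ar: "0 < a r"
    using transient_INF_avoid_pos[OF tr V root_in] a(1)[OF root_in] by simp
  have "0 \<le> ?s" using w unfolding weighted_graph_def by (intro infsum_nonneg) auto
  moreover have "?s \<noteq> 0"
  proof
    assume "?s = 0"
    \<comment> \<open>With total conductance 0 all transition probabilities at \<open>r\<close> are
      0, which would force \<open>a r = 0\<close>.\<close>
    then have "((\<lambda>u. 0) has_sum a r) V" using harm[OF root_in] by (simp add: transition_prob_def)
    then show False using ar has_sum_unique[OF _ has_sum_0] by fastforce
  qed
  ultimately have s: "0 < ?s" by simp
  show ?thesis
  proof
    show "f r = 0" by (simp add: f_def)
    show "0 < a r * ?s" using ar s by simp
    show "0 \<le> f v" "f v \<le> 1" if "v \<in> V" for v using f[OF that] by auto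
    show "f (parent v) \<le> f v" if v: "v \<in> V" "v \<noteq> r" for v
    proof -
      have "ennreal (f (parent v)) \<le> (INF n. avoid V E c r n v)"
      proof (rule INF_greatest)
        fix n
        have "ennreal (f (parent v)) \<le> indicator (- {r}) (parent v) * avoid V E c r n (parent v)"
          unfolding f_eq[OF parent_in[OF v], symmetric] by (intro mult_left_mono INF_lower) auto
        also have "\<dots> \<le> avoid V E c r n v" by (rule avoid_parent_le[OF w pos v])
        finally show "ennreal (f (parent v)) \<le> avoid V E c r n v" .
      qed
      then show ?thesis using a[OF v(1)] v(2) by (simp add: f_def)
    qed
    show "((\<lambda>u. if {x, u} \<in> E then c {x, u} * (f u - f x) else 0)
      has_sum (if x = r then a r * ?s else 0)) V" if x: "x \<in> V" for x
    proof (cases "x = r")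
      case True
      then show ?thesis
        using has_sum_transition_prob_potential[OF w x, of f "a r * ?s"] harm[OF x] s
        by (simp add: f_def)
    next
      case False
      then show ?thesis
        using has_sum_transition_prob_potential[OF w x incident_sum_pos_nonroot[OF w pos x False], of f 0]
          harm[OF x] by (simp add: f_def)
    qed
  qed
qed

end

section \<open>Flow potentials in the changing environment\<close>

context rooted_tree
begin

text \<open>The flow of \<open>f\<close> in the network \<open>c\<close>, taken as a flow in the network \<open>d\<close>: on a tree every
  flow is the gradient of a potential.\<close>

definition flow_potential :: "('v \<Rightarrow> real) \<Rightarrow> ('v set \<Rightarrow> real) \<Rightarrow> ('v set \<Rightarrow> real) \<Rightarrow> 'v \<Rightarrow> real" where
  "flow_potential f c d v = (\<Sum>i<depth v. let x = (parent ^^ i) v in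
     c {parent x, x} * (f x - f (parent x)) / d {parent x, x})"

lemma flow_potential_root [simp]: "flow_potential f c d r = 0"
  by (simp add: flow_potential_def)

lemma flow_potential_parent:
  assumes "v \<in> V" "v \<noteq> r"
  shows "flow_potential f c d v =
    c {parent v, v} * (f v - f (parent v)) / d {parent v, v} + flow_potential f c d (parent v)"
  unfolding flow_potential_def depth_parent[OF assms] sum.lessThan_Suc_shift
  by (simp add: funpow_swap1 Let_def)

text \<open>Both networks carry the same flow through every edge, so the node law satisfied by
  \<open>f\<close> in \<open>c\<close> passes to the new potential in \<open>d\<close>. The two
  cases are the two orientations of the edge.\<close>

lemma flow_potential_edge:
  assumes e: "{x, u} \<in> E" and d: "d {x, u} \<noteq> 0"
  shows "d {x, u} * (flow_potential f c d u - flow_potential f c d x) = c {x, u} * (f u - f x)"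
  using edge_parent[OF e]
proof
  assume "x \<noteq> r \<and> parent x = u"
  then show ?thesis using flow_potential_parent[OF edge_in(1)[OF e], of f c d] d
    by (simp add: insert_commute field_simps)
next
  assume "u \<noteq> r \<and> parent u = x"
  then show ?thesis using flow_potential_parent[OF edge_in(2)[OF e], of f c d] d by simp
qed

text \<open>The flow is nonnegative in the direction away from the root and does not depend on
  \<open>d\<close>; lowering the conductances raises every quotient along the path.\<close>

lemma flow_potential_antimono:
  assumes "\<And>v. v \<in> V \<Longrightarrow> v \<noteq> r \<Longrightarrow> f (parent v) \<le> f v" "\<And>e. e \<in> E \<Longrightarrow> 0 \<le> c e"
    and d: "\<And>e. e \<in> E \<Longrightarrow> 0 < d' e" "\<And>e. e \<in> E \<Longrightarrow> d' e \<le> d e"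
    and "v \<in> V"
  shows "flow_potential f c d v \<le> flow_potential f c d' v"
  using \<open>v \<in> V\<close>
proof (induction v rule: depth_induct)
  case (parent v)
  note e = parent_edge[OF parent.hyps]
  have "0 < d {parent v, v}" using d[OF e] by linarith
  with parent show ?case
    unfolding flow_potential_parent[OF parent.hyps]
    using assms(1,2) d e
    by (intro add_mono divide_left_mono mult_nonneg_nonneg mult_pos_pos) auto
qed simp

lemma flow_potential_nonneg:
  assumes "\<And>v. v \<in> V \<Longrightarrow> v \<noteq> r \<Longrightarrow> f (parent v) \<le> f v" "\<And>e. e \<in> E \<Longrightarrow> 0 \<le> c e"
    and "\<And>e. e \<in> E \<Longrightarrow> 0 \<le> d e" and "v \<in> V"
  shows "0 \<le> flow_potential f c d v"
  using \<open>v \<in> V\<close>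
proof (induction v rule: depth_induct)
  case (parent v)
  then show ?case
    unfolding flow_potential_parent[OF parent.hyps]
    using assms(1-3) parent_edge[OF parent.hyps]
    by (intro add_nonneg_nonneg divide_nonneg_nonneg mult_nonneg_nonneg) auto
qed simp

text \<open>The quotients reduce to increments of \<open>f\<close> and telescope. Together with
  antimonotonicity this bounds the potential of any environment above \<open>c\<close> by
  \<open>f\<close>.\<close>

lemma flow_potential_same:
  assumes "\<And>e. e \<in> E \<Longrightarrow> c e \<noteq> 0" and "v \<in> V"
  shows "flow_potential f c c v = f v - f r"
  using \<open>v \<in> V\<close>
proof (induction v rule: depth_induct)
  case (parent v)
  then show ?case
    unfolding flow_potential_parent[OF parent.hyps]
    using assms(1) parent_edge[OF parent.hyps] by simp
qed simp

text \<open>The gains at visits to \<open>r\<close> have total expectation at most 1, so their sum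
  is almost surely finite, while infinitely many visits would make it infinite.\<close>

lemma AE_finite_root_visits:
  assumes rw: "rwce M V E X C"
    and proper: "proper_environment M E C"
    and mono: "monotone_decreasing_environment M E C"
    and tr: "transient_weighted_graph V E c"
    and pos: "\<forall>e\<in>E. 0 < c e"
    and lower: "AE \<omega> in M. \<forall>t. \<forall>e\<in>E. c e \<le> C t \<omega> e"
  shows "AE \<omega> in M. finite {t. X t \<omega> = r}"
proof -
  interpret rwce M V E X C by (rule rw)
  have w: "weighted_graph V E c" using tr unfolding transient_weighted_graph_def by simp
  have V: "countable V" by (rule countable_vertices_weighted[OF w pos])
  have "countable ((\<lambda>(u, v). {u, v}) ` (V \<times> V))" using V by blast
  moreover have "E \<subseteq> (\<lambda>(u, v). {u, v}) ` (V \<times> V)"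
  proof
    fix e assume "e \<in> E"
    then have "card e = 2" "e \<subseteq> V" using w unfolding weighted_graph_def simple_graph_def by auto
    then show "e \<in> (\<lambda>(u, v). {u, v}) ` (V \<times> V)" by (auto simp: card_2_iff)
  qed
  ultimately have E: "countable E" by (rule countable_subset[rotated])
  obtain f D where f: "f r = 0" "0 < D" "\<And>v. v \<in> V \<Longrightarrow> 0 \<le> f v" "\<And>v. v \<in> V \<Longrightarrow> f v \<le> 1"
    and f_parent: "\<And>v. v \<in> V \<Longrightarrow> v \<noteq> r \<Longrightarrow> f (parent v) \<le> f v"
    and flow: "\<And>x. x \<in> V \<Longrightarrow> ((\<lambda>u. if {x, u} \<in> E then c {x, u} * (f u - f x) else 0)
      has_sum (if x = r then D else 0)) V"
  proof (rule escape_potential[OF tr pos], goal_cases)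
    case (1 f D)
    show ?thesis by (rule that[of f D]) (fact 1)+
  qed
  \<comment> \<open>An isolated root could not emit the flow \<open>D > 0\<close>. The edge found
    here makes the total conductance at \<open>r\<close> positive.\<close>
  have "\<exists>u. {r, u} \<in> E"
  proof (rule ccontr)
    assume "\<not> ?thesis"
    then have "((\<lambda>u. 0) has_sum D) V" using flow[OF root_in] by simp
    then show False using f(2) has_sum_unique[OF _ has_sum_0] by fastforce
  qed
  then obtain u where u: "{r, u} \<in> E" ..
  define s where "s t \<omega> = (\<Sum>\<^sub>\<infinity>e\<in>{e\<in>E. r \<in> e}. C t \<omega> e)" for t \<omega>
  define good where "good \<omega> \<longleftrightarrow> \<omega> \<in> space M \<and> (\<forall>t. \<forall>e\<in>E. 0 < C t \<omega> e) \<and>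
    (\<forall>t. \<forall>e\<in>E. C (Suc t) \<omega> e \<le> C t \<omega> e) \<and> (\<forall>t. \<forall>e\<in>E. c e \<le> C t \<omega> e)" for \<omega>
  have good: "AE \<omega> in M. good \<omega>"
    using proper mono lower AE_space unfolding proper_environment_def monotone_decreasing_environment_def
    by eventually_elim (simp add: good_def)
  have s_pos: "0 < s t \<omega>" if "good \<omega>" for t \<omega>
    using incident_sum_pos[OF weighted[of \<omega> t] root_in u] that u unfolding s_def good_def by auto
  have s_le: "s t \<omega> \<le> s 0 \<omega>" if "good \<omega>" for t \<omega>
  proof -
    have summable: "C t \<omega> summable_on {e \<in> E. r \<in> e}" for t
      using weighted[of \<omega> t] that root_in unfolding weighted_graph_def good_def by auto
    show ?thesis
      unfolding s_def
    proof (rule infsum_mono[OF summable summable])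
      fix e assume e: "e \<in> {e \<in> E. r \<in> e}"
      with that have "\<And>t. C (Suc t) \<omega> e \<le> C t \<omega> e" unfolding good_def by blast
      then show "C t \<omega> e \<le> C 0 \<omega> e"
        using lift_Suc_antimono_le[of "\<lambda>t. C t \<omega> e" 0 t] by simp
    qed
  qed
  define h where "h t \<omega> = flow_potential f c (C t \<omega>)" for t \<omega>
  define Y where "Y t \<omega> = ennreal (h t \<omega> (X t \<omega>))" for t \<omega>
  \<comment> \<open>The expected one-step gain of the potential in the environment of time
    \<open>t\<close>: \<open>D / s t \<omega>\<close> at \<open>r\<close> and 0 elsewhere.\<close>
  define \<nu> where "\<nu> t \<omega> = indicator {r} (X t \<omega>) * ennreal (D / s t \<omega>)" for t \<omega>
  have h_nonneg: "0 \<le> h t \<omega> v" if "\<omega> \<in> space M" "v \<in> V" for t \<omega> v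
    unfolding h_def using weighted[OF that(1), of t] that(2) pos f_parent
    by (intro flow_potential_nonneg) (auto simp: weighted_graph_def intro: less_imp_le)
  \<comment> \<open>Only the finitely many conductances between \<open>v\<close> and
    \<open>r\<close> at time \<open>t\<close> enter, so the history determines the
    potential.\<close>
  have h_history: "(\<lambda>\<omega>. h t \<omega> v) \<in> borel_measurable (history M V E X C t)" if v: "v \<in> V" for t v
    unfolding h_def flow_potential_def Let_def
    by (intro borel_measurable_sum borel_measurable_divide C_history borel_measurable_const)
      (use funpow_parent[OF v] parent_edge in auto)
  have Y_meas: "Y t \<in> borel_measurable M" for t
  proof -
    have "(\<lambda>\<omega>. h t \<omega> (X t \<omega>)) \<in> borel_measurable M"
      by (rule measurable_compose_countable'[OF _ X_measurable V])
        (rule measurable_from_subalg[OF subalgebra_history h_history])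
    then show ?thesis unfolding Y_def by simp
  qed
  have \<nu>_meas: "\<nu> t \<in> borel_measurable M" for t
  proof -
    have "(\<lambda>\<omega>. indicator {r} (X t \<omega>) :: ennreal) \<in> borel_measurable M"
      by (rule measurable_compose[OF X_measurable]) auto
    then show ?thesis
      unfolding \<nu>_def s_def using incident_sum_measurable[OF E, where x = r and t = t] by simp
  qed
  \<comment> \<open>The step is split in two: first the walk moves in the environment of time
    \<open>t\<close>, which gains \<open>\<nu> t\<close>; then the conductances drop, which raises
    the potential pointwise.\<close>
  have step_le: "integral\<^sup>N M (Y t) + integral\<^sup>N M (\<nu> t) \<le> integral\<^sup>N M (Y (Suc t))" for t
  proof -
    have "integral\<^sup>N M (Y t) + integral\<^sup>N M (\<nu> t) = (\<integral>\<^sup>+\<omega>. Y t \<omega> + \<nu> t \<omega> \<partial>M)"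
      by (rule nn_integral_add[OF Y_meas \<nu>_meas, symmetric])
    also have "\<dots> = (\<integral>\<^sup>+\<omega>. (\<integral>\<^sup>+v. ennreal (h t \<omega> v) *
        ennreal (transition_prob E (C t \<omega>) (X t \<omega>) v) \<partial>count_space V) \<partial>M)"
    proof (rule nn_integral_cong_AE)
      show "AE \<omega> in M. Y t \<omega> + \<nu> t \<omega> = (\<integral>\<^sup>+v. ennreal (h t \<omega> v) *
        ennreal (transition_prob E (C t \<omega>) (X t \<omega>) v) \<partial>count_space V)"
        using good
      proof eventually_elim
        case (elim \<omega>)
        then have \<omega>: "\<omega> \<in> space M" and C_pos: "\<forall>e\<in>E. 0 < C t \<omega> e" unfolding good_def by auto
        define x where "x = X t \<omega>"
        have x: "x \<in> V" using X_in[OF \<omega>] by (simp add: x_def)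
        let ?s = "\<Sum>\<^sub>\<infinity>e\<in>{e\<in>E. x \<in> e}. C t \<omega> e"
        have s: "0 < ?s"
        proof (cases "x = r")
          case True
          then show ?thesis using s_pos[OF elim, of t] by (simp add: s_def)
        next
          case False
          then show ?thesis by (rule incident_sum_pos_nonroot[OF weighted[OF \<omega>] C_pos x])
        qed
        have eq: "(if {x, u} \<in> E then C t \<omega> {x, u} * (h t \<omega> u - h t \<omega> x) else 0) =
          (if {x, u} \<in> E then c {x, u} * (f u - f x) else 0)" for u
          unfolding h_def using flow_potential_edge[of x u "C t \<omega>" f c] C_pos by auto
        have "((\<lambda>u. transition_prob E (C t \<omega>) x u * h t \<omega> u) has_sum
            h t \<omega> x + (if x = r then D else 0) / ?s) V"
          unfolding has_sum_transition_prob_potential[OF weighted[OF \<omega>] x s] eq by (rule flow[OF x])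
        from nn_integral_count_space_has_sum[OF this]
        have "(\<integral>\<^sup>+v. ennreal (h t \<omega> v) * ennreal (transition_prob E (C t \<omega>) x v) \<partial>count_space V) =
            ennreal (h t \<omega> x + (if x = r then D else 0) / ?s)"
          using h_nonneg[OF \<omega>] transition_prob_nonneg[OF weighted[OF \<omega>]]
          by (simp add: ennreal_mult' mult.commute cong: nn_integral_cong_simp)
        also have "\<dots> = Y t \<omega> + \<nu> t \<omega>"
          using h_nonneg[OF \<omega> x] f(2) s by (auto simp: Y_def \<nu>_def s_def x_def ennreal_plus)
        finally show ?case by (simp add: x_def)
      qed
    qed
    \<comment> \<open>The old potential at the new position: the payoff
      \<open>h t \<omega> v\<close> is known at time \<open>t\<close>, however the next environment
      is chosen.\<close>
    also have "\<dots> = (\<integral>\<^sup>+\<omega>. ennreal (h t \<omega> (X (Suc t) \<omega>)) \<partial>M)"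
      by (rule nn_integral_step[OF V, symmetric, of "\<lambda>v \<omega>. ennreal (h t \<omega> v)"]) (use h_history in simp)
    also have "\<dots> \<le> integral\<^sup>N M (Y (Suc t))"
    proof (rule nn_integral_mono_AE)
      show "AE \<omega> in M. ennreal (h t \<omega> (X (Suc t) \<omega>)) \<le> Y (Suc t) \<omega>"
        using good
      proof eventually_elim
        case (elim \<omega>)
        then show ?case
          unfolding Y_def h_def using pos f_parent X_in
          by (intro ennreal_leI flow_potential_antimono) (auto simp: good_def intro: less_imp_le)
      qed
    qed
    finally show ?thesis .
  qed
  have Y_le: "integral\<^sup>N M (Y t) \<le> 1" for t
  proof -
    have "integral\<^sup>N M (Y t) \<le> (\<integral>\<^sup>+\<omega>. 1 \<partial>M)"
    proof (rule nn_integral_mono_AE)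
      show "AE \<omega> in M. Y t \<omega> \<le> 1"
        using good
      proof eventually_elim
        case (elim \<omega>)
        then have x: "X t \<omega> \<in> V" using X_in unfolding good_def by blast
        \<comment> \<open>The lower bound \<open>c\<close> enters here: replacing the environment by
          \<open>c\<close> can only raise the potential, and there it equals
          \<open>f\<close>.\<close>
        have "h t \<omega> (X t \<omega>) \<le> flow_potential f c c (X t \<omega>)"
          unfolding h_def using elim pos f_parent x
          by (intro flow_potential_antimono) (auto simp: good_def intro: less_imp_le)
        also have "\<dots> \<le> 1"
          using flow_potential_same[of c "X t \<omega>" f] pos x f(1) f(4)[OF x] by force
        finally show ?case by (simp add: Y_def)
      qed
    qed
    then show ?thesis by (simp add: emeasure_space_1)
  qed
  \<comment> \<open>The one-step inequalities add up; the nonnegative initial term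
    \<open>Y 0\<close> is dropped.\<close>
  have "(\<Sum>t<n. integral\<^sup>N M (\<nu> t)) \<le> integral\<^sup>N M (Y n)" for n
  proof (induction n)
    case (Suc n)
    then have "(\<Sum>t<Suc n. integral\<^sup>N M (\<nu> t)) \<le> integral\<^sup>N M (Y n) + integral\<^sup>N M (\<nu> n)"
      by (simp add: add_right_mono)
    then show ?case using step_le[of n] by (rule order_trans)
  qed simp
  then have "(\<Sum>t. integral\<^sup>N M (\<nu> t)) \<le> 1"
    using Y_le by (intro suminf_le_const summableI) (blast intro: order_trans)+
  then have "(\<integral>\<^sup>+\<omega>. (\<Sum>t. \<nu> t \<omega>) \<partial>M) \<noteq> \<infinity>"
    using nn_integral_suminf[OF \<nu>_meas] by (auto simp: top_unique)
  then have "AE \<omega> in M. (\<Sum>t. \<nu> t \<omega>) \<noteq> \<infinity>"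
    using \<nu>_meas by (intro nn_integral_PInf_AE) auto
  with good show ?thesis
  proof eventually_elim
    case (elim \<omega>)
    let ?S = "{t. X t \<omega> = r}"
    show ?case
    proof (rule ccontr)
      assume inf: "infinite ?S"
      \<comment> \<open>As the total conductance at \<open>r\<close> only decreases, each visit
        contributes at least \<open>D / s 0 \<omega>\<close>, a positive amount independent of
        \<open>t\<close>.\<close>
      have "ennreal (D / s 0 \<omega>) * indicator ?S t \<le> \<nu> t \<omega>" for t
        using f(2) s_le[OF elim(1), of t] s_pos[OF elim(1)]
        by (auto simp: \<nu>_def intro!: ennreal_leI divide_left_mono split: split_indicator)
      then have "(\<integral>\<^sup>+t. ennreal (D / s 0 \<omega>) * indicator ?S t \<partial>count_space UNIV) \<le>
          (\<integral>\<^sup>+t. \<nu> t \<omega> \<partial>count_space UNIV)"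
        by (intro nn_integral_mono) auto
      moreover have "(\<integral>\<^sup>+t. ennreal (D / s 0 \<omega>) * indicator ?S t \<partial>count_space UNIV) = \<infinity>"
        using inf f(2) s_pos[OF elim(1), of 0]
        by (simp add: nn_integral_cmult_indicator ennreal_mult_top)
      ultimately show False
        using elim(2) by (simp add: nn_integral_count_space_nat top_unique)
    qed
  qed
qed

end

theorem theorem5p2:
  fixes M :: "'w measure"
    and V :: "'v set"
    and E :: "'v set set"
    and X :: "nat \<Rightarrow> 'w \<Rightarrow> 'v"
    and C :: "nat \<Rightarrow> 'w \<Rightarrow> 'v set \<Rightarrow> real"
    and C_inf :: "'v set \<Rightarrow> real"
  assumes "tree_graph V E"
    and "rwce M V E X C"
    and "proper_environment M E C"
    and "monotone_decreasing_environment M E C"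
    and "transient_weighted_graph V E C_inf"
    and "\<forall>e\<in>E. 0 < C_inf e"
    and "AE \<omega> in M. \<forall>t. \<forall>e\<in>E. C_inf e \<le> C t \<omega> e"
  shows "transient_process M V X"
proof -
  have root: "rooted_tree V E r" if "r \<in> V" for r
    using assms(1) that by unfold_locales
  obtain r where "r \<in> V" using assms(1) unfolding tree_graph_def by blast
  \<comment> \<open>Countability lets the null sets of the individual roots be merged into
    one.\<close>
  then have "countable V"
    using rooted_tree.countable_vertices_weighted[OF root] assms(5,6)
    unfolding transient_weighted_graph_def by blast
  moreover have "\<forall>v\<in>V. AE \<omega> in M. finite {t. X t \<omega> = v}"
    using rooted_tree.AE_finite_root_visits[OF root] assms(2-7) by blast
  ultimately show ?thesis
    unfolding transient_process_def by (simp add: AE_ball_countable)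
qed

end
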